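(* Let $I\subseteq(0,\infty)$ be an interval, let $f:I\to\mathbb{R}$ be differentiable on the interior $I^{\circ}$ of $I$, let $a,b\in I$ with $a\le b$, and let $h:[a,b]\to[0,\infty)$ be differentiable. Put $G=\sqrt{ab}$. If $f'\in L(a,b)$, then $$\left[h(b)-2h(a)\right]\frac{f(a)}{2}+h(b)\frac{f(b)}{2}-\int_a^b f(x)h'(x)\,dx$$ $$=\frac{\ln b-\ln a}{4}\left\{\int_0^1\left[2h\left(a^tG^{1-t}\right)-h(b)\right]f'\left(a^tG^{1-t}\right)a^tG^{1-t}\,dt+\int_0^1\left[2h\left(b^tG^{1-t}\right)-h(b)\right]f'\left(b^tG^{1-t}\right)b^tG^{1-t}\,dt\right\}.$$
   Context: $L(a,b)$ denotes the set of integrable functions on the interval with endpoints $a$ and $b$.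
   Formalization: It is additionally assumed that f is continuous on [a,b]; this matters only if a or b is an endpoint of I, where f could jump and the identity fails (I=[1,2], a=1, b=2, h=1, f(1)=1, f=0 on (1,2]: left side -1/2, right side 0). *)

theory Defs
  imports "HOL-Analysis.Analysis"
begin

end

theory Submission
  imports Defs
begin

text \<open>
  The substitutions \<open>x = a\<^sup>tG\<^sup>1\<^sup>-\<^sup>t\<close> and \<open>x = b\<^sup>tG\<^sup>1\<^sup>-\<^sup>t\<close> map \<open>[0,1]\<close> onto \<open>[a,G]\<close> and \<open>[G,b]\<close>, each with
  logarithmic derivative of modulus \<open>(ln b - ln a) / 2\<close>, so the right-hand side is half the
  integral of \<open>(2h - h(b)) f'\<close> over \<open>[a,b]\<close>, and integration by parts gives the left-hand side.
  The derivative of \<open>h\<close> is not assumed integrable: integrability of \<open>f h'\<close> comes from the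
  fundamental theorem for the Henstock-Kurzweil integral, as \<open>f h' = (h f)' - h f'\<close> with \<open>h f'\<close>
  absolutely integrable.
\<close>

lemma powr_interpolation_eq_exp:
  fixes p q t :: real
  assumes "p > 0" "q > 0"
  shows "p powr t * q powr (1 - t) = exp (ln q + t * (ln p - ln q))"
  using assms by (simp add: powr_def algebra_simps flip: exp_add)

text \<open>The curve is \<open>exp\<close> of an affine function of \<open>t\<close>, hence
  injective when \<open>p \<noteq> q\<close>, with derivative \<open>ln p - ln q\<close> times
  itself. The modulus and \<open>closed_segment\<close> cover both orientations: below,
  \<open>q\<close> is \<open>G\<close> while \<open>p\<close> is \<open>a < G\<close> or
  \<open>b > G\<close>.\<close>

lemma has_absolute_integral_powr_interpolation:
  fixes F :: "real \<Rightarrow> real" and p q :: real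
  assumes pos: "p > 0" "q > 0" and neq: "p \<noteq> q"
    and F: "F absolutely_integrable_on closed_segment p q"
  shows "(\<lambda>t. F (p powr t * q powr (1 - t)) * (p powr t * q powr (1 - t)))
      absolutely_integrable_on {0..1}"
    and "\<bar>ln p - ln q\<bar> * integral {0..1} (\<lambda>t. F (p powr t * q powr (1 - t)) * (p powr t * q powr (1 - t)))
      = integral (closed_segment p q) F"
proof -
  define \<phi> where "\<phi> = (\<lambda>t. exp (ln q + t * (ln p - ln q)))"
  define c where "c = \<bar>ln p - ln q\<bar>"
  have ne: "ln p \<noteq> ln q" using pos neq by simp
  have \<phi>_eq: "p powr t * q powr (1 - t) = \<phi> t" for t
    unfolding \<phi>_def by (rule powr_interpolation_eq_exp[OF pos])
  have der: "(\<phi> has_field_derivative (ln p - ln q) * \<phi> t) (at t within {0..1})" for t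
    unfolding \<phi>_def by (auto intro!: derivative_eq_intros)
  have inj: "inj_on \<phi> {0..1}"
    using ne by (auto simp: inj_on_def \<phi>_def)
  have "\<phi> ` closed_segment 0 1 = closed_segment (\<phi> 0) (\<phi> 1)"
    by (rule continuous_injective_image_segment_1)
      (use inj in \<open>auto simp: closed_segment_eq_real_ivl \<phi>_def intro!: continuous_intros\<close>)
  moreover have "\<phi> 0 = q" "\<phi> 1 = p"
    using pos by (auto simp: \<phi>_def)
  ultimately have image: "\<phi> ` {0..1} = closed_segment p q"
    by (simp add: closed_segment_eq_real_ivl closed_segment_commute)
  \<comment> \<open>Since \<open>\<phi>\<close> is positive, the modulus of the Jacobian falls on
    the constant only; the factor \<open>\<phi> t\<close> that remains is the one in the target
    integrand.\<close>
  have scaled: "\<bar>(ln p - ln q) * \<phi> t\<bar> * F (\<phi> t) = c * (F (\<phi> t) * \<phi> t)" for t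
    by (simp add: abs_mult c_def \<phi>_def)
  have cov: "(\<lambda>t. c * (F (\<phi> t) * \<phi> t)) absolutely_integrable_on {0..1} \<and>
      integral {0..1} (\<lambda>t. c * (F (\<phi> t) * \<phi> t)) = integral (closed_segment p q) F"
    using has_absolute_integral_change_of_variables_1'[of "{0..1}" \<phi> "\<lambda>t. (ln p - ln q) * \<phi> t" F
        "integral (closed_segment p q) F"] der inj F
    unfolding image scaled by auto
  have c: "c \<noteq> 0" using ne by (simp add: c_def)
  have "(\<lambda>t. inverse c * (c * (F (\<phi> t) * \<phi> t))) absolutely_integrable_on {0..1}"
    using cov by (intro set_integrable_mult_right) auto
  then show "(\<lambda>t. F (p powr t * q powr (1 - t)) * (p powr t * q powr (1 - t)))
      absolutely_integrable_on {0..1}"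
    using c by (simp add: \<phi>_eq field_simps)
  show "\<bar>ln p - ln q\<bar> * integral {0..1} (\<lambda>t. F (p powr t * q powr (1 - t)) * (p powr t * q powr (1 - t)))
      = integral (closed_segment p q) F"
    using cov by (simp add: \<phi>_eq c_def)
qed

lemma absolutely_integrable_continuous_mult:
  fixes g k :: "real \<Rightarrow> real"
  assumes "continuous_on {a..b} k" and "g absolutely_integrable_on {a..b}"
  shows "(\<lambda>x. k x * g x) absolutely_integrable_on {a..b}"
proof (rule absolutely_integrable_bounded_measurable_product_real)
  show "k \<in> borel_measurable (lebesgue_on {a..b})"
    using assms by (intro continuous_imp_measurable_on_sets_lebesgue) auto
  show "bounded (k ` {a..b})"
    using assms by (intro compact_imp_bounded compact_continuous_image) auto
qed (use assms in auto)

text \<open>Derivatives are asked for on the open interval only, because \<open>a\<close> or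
  \<open>b\<close> may be an endpoint of \<open>I\<close>, where \<open>f\<close> is merely
  continuous.\<close>

lemma has_integral_by_parts_interior:
  fixes f h f' h' :: "real \<Rightarrow> real"
  assumes "a \<le> b" and "continuous_on {a..b} f" "continuous_on {a..b} h"
    and f': "\<And>x. x \<in> {a<..<b} \<Longrightarrow> (f has_field_derivative f' x) (at x)"
    and h': "\<And>x. x \<in> {a<..<b} \<Longrightarrow> (h has_field_derivative h' x) (at x)"
    and "(\<lambda>x. h x * f' x) integrable_on {a..b}"
  shows "((\<lambda>x. f x * h' x) has_integral
      h b * f b - h a * f a - integral {a..b} (\<lambda>x. h x * f' x)) {a..b}"
proof -
  have "((\<lambda>x. h x * f' x + f x * h' x) has_integral (h b * f b - h a * f a)) {a..b}"
  proof (rule fundamental_theorem_of_calculus_interior)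
    show "((\<lambda>x. h x * f x) has_vector_derivative h x * f' x + f x * h' x) (at x)"
      if "x \<in> {a<..<b}" for x
      unfolding has_real_derivative_iff_has_vector_derivative[symmetric]
      using DERIV_mult[OF h'[OF that] f'[OF that]] by (simp add: algebra_simps)
  qed (use assms in \<open>auto intro!: continuous_intros\<close>)
  from has_integral_diff[OF this integrable_integral[OF assms(6)]] show ?thesis
    by simp
qed

theorem lemma2:
  fixes I :: "real set" and f h :: "real \<Rightarrow> real" and a b G :: real
  assumes "is_interval I" and "I \<subseteq> {0<..}"
    and "f differentiable_on interior I"
    and "a \<in> I" and "b \<in> I" and "a \<le> b"
    and "continuous_on {a..b} f"
    and "h \<in> {a..b} \<rightarrow> {0..}"
    and "h differentiable_on {a..b}"
    and "G = sqrt (a * b)"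
    and "deriv f absolutely_integrable_on {a<..<b}"
  shows "(\<lambda>x. f x * vector_derivative h (at x within {a..b})) integrable_on {a..b} \<and>
    (\<lambda>t. (2 * h (a powr t * G powr (1 - t)) - h b)
       * deriv f (a powr t * G powr (1 - t)) * (a powr t * G powr (1 - t)))
      integrable_on {0..1} \<and>
    (\<lambda>t. (2 * h (b powr t * G powr (1 - t)) - h b)
       * deriv f (b powr t * G powr (1 - t)) * (b powr t * G powr (1 - t)))
      integrable_on {0..1} \<and>
    (h b - 2 * h a) * (f a / 2) + h b * (f b / 2)
      - integral {a..b} (\<lambda>x. f x * vector_derivative h (at x within {a..b}))
    = (ln b - ln a) / 4 *
      (integral {0..1} (\<lambda>t. (2 * h (a powr t * G powr (1 - t)) - h b)
         * deriv f (a powr t * G powr (1 - t)) * (a powr t * G powr (1 - t)))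
     + integral {0..1} (\<lambda>t. (2 * h (b powr t * G powr (1 - t)) - h b)
         * deriv f (b powr t * G powr (1 - t)) * (b powr t * G powr (1 - t))))"
proof (cases "a = b")
  \<comment> \<open>Here \<open>G = a\<close> and the curve is constant, so there is no substitution
    to make; both sides vanish, as \<open>ln b - ln a = 0\<close> and the interval is a
    point.\<close>
  case True
  have "a > 0" using assms(2,4) by auto
  then have const: "a powr t * G powr (1 - t) = a" for t
    using True assms(10) by (simp flip: powr_add)
  show ?thesis
    using True integrable_on_refl[of _ b] by (auto simp: const[unfolded True] algebra_simps)
next
  case False
  then have ab: "a < b" using assms(6) by simp
  have pos: "a > 0" "b > 0" using assms(2,4,5) by auto
  \<comment> \<open>\<open>G\<close> splits \<open>[a,b]\<close> into two nondegenerate pieces of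
    equal logarithmic length.\<close>
  have G: "a < G" "G < b" and lnG: "ln G = (ln a + ln b) / 2"
  proof -
    have "a * a < a * b" "a * b < b * b" using ab pos by auto
    then show "a < G" "G < b"
      using pos ab by (auto simp: assms(10) power2_eq_square intro!: real_less_rsqrt real_less_lsqrt)
    show "ln G = (ln a + ln b) / 2" using pos by (simp add: assms(10) ln_sqrt ln_mult)
  qed
  have G0: "G > 0" using G pos by simp
  define F where "F = (\<lambda>x. (2 * h x - h b) * deriv f x)"
  define h' where "h' = (\<lambda>x. vector_derivative h (at x within {a..b}))"

  have "{a..b} \<subseteq> I"
    using assms(1,4,5) by (meson atLeastAtMost_iff mem_is_interval_1_I subsetI)
  then have "{a<..<b} \<subseteq> interior I"
    by (intro interior_maximal) auto
  then have f': "(f has_field_derivative deriv f x) (at x)" if "x \<in> {a<..<b}" for x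
    using assms(3) that
    by (metis DERIV_deriv_iff_real_differentiable at_within_open differentiable_on_def open_interior subsetD)
  \<comment> \<open>At interior points the derivative within \<open>{a..b}\<close> is the two-sided
    one.\<close>
  have h': "(h has_field_derivative h' x) (at x)" if "x \<in> {a<..<b}" for x
  proof -
    have "h differentiable (at x within {a..b})"
      using assms(9) that by (auto simp: differentiable_on_def)
    then have "(h has_vector_derivative h' x) (at x within {a..b})"
      by (simp add: vector_derivative_works h'_def)
    then show ?thesis
      using that by (simp add: at_within_Icc_at has_real_derivative_iff_has_vector_derivative)
  qed
  have ch: "continuous_on {a..b} h"
    using assms(9) by (rule differentiable_imp_continuous_on)
  \<comment> \<open>The endpoints form a null set, so the values of \<open>deriv f\<close> there are
    harmless.\<close>
  have af': "deriv f absolutely_integrable_on {a..b}"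
    using assms(11) by (simp add: absolutely_integrable_on_Icc_iff_Ioo)
  have hf': "(\<lambda>x. h x * deriv f x) absolutely_integrable_on {a..b}"
    using ch af' by (rule absolutely_integrable_continuous_mult)
  have aF: "F absolutely_integrable_on {a..b}"
    unfolding F_def
    by (rule absolutely_integrable_continuous_mult[OF _ af']) (use ch in \<open>auto intro!: continuous_intros\<close>)

  have parts: "((\<lambda>x. f x * h' x) has_integral
      h b * f b - h a * f a - integral {a..b} (\<lambda>x. h x * deriv f x)) {a..b}"
    by (rule has_integral_by_parts_interior)
      (use assms(6,7) ch f' h' hf' set_lebesgue_integral_eq_integral(1) in auto)
  have ftc: "(deriv f has_integral (f b - f a)) {a..b}"
    using assms(6,7) f'
    by (intro fundamental_theorem_of_calculus_interior)
      (auto simp: has_real_derivative_iff_has_vector_derivative)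
  \<comment> \<open>Split \<open>F\<close> as \<open>2 * h * deriv f\<close> minus
    \<open>h b * deriv f\<close>; the second term integrates by the fundamental theorem.\<close>
  have "(F has_integral 2 * integral {a..b} (\<lambda>x. h x * deriv f x) - h b * (f b - f a)) {a..b}"
    using has_integral_diff[OF has_integral_mult_right[of _ _ _ 2, OF integrable_integral] has_integral_mult_right[of _ _ _ "h b", OF ftc],
        of "\<lambda>x. h x * deriv f x"] set_lebesgue_integral_eq_integral(1)[OF hf']
    by (simp add: F_def algebra_simps)
  then have intF: "integral {a..b} F = 2 * integral {a..b} (\<lambda>x. h x * deriv f x) - h b * (f b - f a)"
    by (rule integral_unique)
  have split: "integral {a..G} F + integral {G..b} F = integral {a..b} F"
    using G aF by (intro Henstock_Kurzweil_Integration.integral_combine)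
      (auto intro: set_lebesgue_integral_eq_integral(1))

  have segs: "closed_segment a G = {a..G}" "closed_segment b G = {G..b}"
    using G by (auto simp: closed_segment_eq_real_ivl)
  have "F absolutely_integrable_on closed_segment a G" "F absolutely_integrable_on closed_segment b G"
    unfolding segs using G by (auto intro: absolutely_integrable_on_subinterval[OF aF])
  note sub_a = has_absolute_integral_powr_interpolation[OF pos(1) G0 _ this(1)]
    and sub_b = has_absolute_integral_powr_interpolation[OF pos(2) G0 _ this(2)]
  have ln_ab: "ln a < ln b" using ab pos by simp
  \<comment> \<open>As \<open>ln G\<close> is the midpoint of \<open>ln a\<close> and
    \<open>ln b\<close>, both substitutions carry the same factor and their integrals can be
    added.\<close>
  have half: "\<bar>ln a - ln G\<bar> = (ln b - ln a) / 2" "\<bar>ln b - ln G\<bar> = (ln b - ln a) / 2"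
    unfolding lnG using ln_ab by (auto simp: abs_if field_simps)
  define Ja where "Ja = integral {0..1} (\<lambda>t. F (a powr t * G powr (1 - t)) * (a powr t * G powr (1 - t)))"
  define Jb where "Jb = integral {0..1} (\<lambda>t. F (b powr t * G powr (1 - t)) * (b powr t * G powr (1 - t)))"
  have "(ln b - ln a) / 2 * Ja = integral {a..G} F" "(ln b - ln a) / 2 * Jb = integral {G..b} F"
    using sub_a(2) sub_b(2) G unfolding half segs Ja_def Jb_def by auto
  then have "(ln b - ln a) / 4 * (Ja + Jb) = integral {a..b} F / 2"
    using split by (simp add: algebra_simps)
  \<comment> \<open>With \<open>H\<close> the integral of \<open>h * deriv f\<close>, both sides
    equal \<open>H - h b * (f b - f a) / 2\<close>: the left by \<open>parts\<close>, the right by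
    \<open>intF\<close>.\<close>
  then have "(h b - 2 * h a) * (f a / 2) + h b * (f b / 2) - integral {a..b} (\<lambda>x. f x * h' x)
      = (ln b - ln a) / 4 * (Ja + Jb)"
    using integral_unique[OF parts] by (simp add: intF field_simps)
  moreover have "(\<lambda>x. f x * h' x) integrable_on {a..b}"
    using parts by blast
  moreover have "(\<lambda>t. F (a powr t * G powr (1 - t)) * (a powr t * G powr (1 - t))) integrable_on {0..1}"
    "(\<lambda>t. F (b powr t * G powr (1 - t)) * (b powr t * G powr (1 - t))) integrable_on {0..1}"
    using sub_a(1) sub_b(1) G by (auto intro: set_lebesgue_integral_eq_integral(1))
  ultimately show ?thesis
    unfolding Ja_def Jb_def F_def h'_def by blast
qed

end
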